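(* Let $r \ge 3$ and let $\mathcal{H}$ be a friendship $r$-hypergraph on $n \ge r+1$ vertices. Then $$|E(\mathcal{H})| \ge \frac{r+1}{r}\binom{n-1}{r-1}.$$ Moreover, equality holds if and only if $\mathcal{H}$ is universal.
   Context: An $r$-uniform hypergraph is a set of vertices together with a family of $r$-element subsets (hyperedges). For an $r$-uniform hypergraph $\mathcal{H}$ and a set of vertices $A$, a vertex $u \notin A$ is a friend of $A$ in $\mathcal{H}$ if for every $B \subseteq A$ with $|B| = r-1$, the set $B \cup \{u\}$ is a hyperedge of $\mathcal{H}$. An $r$-uniform hypergraph is a friendship $r$-hypergraph if every set of $r$ vertices has exactly one friend. An $S(r-1,r,m)$ Steiner system is an $r$-uniform hypergraph on $m$ vertices in which every set of $r-1$ vertices lies in exactly one hyperedge. Given such a Steiner system $\mathcal{S}$ on $n-1$ vertices, $U_r(\mathcal{S})$ is the $r$-uniform hypergraph on $V(\mathcal{S}) \cup \{u\}$ (with $u$ a new vertex) whose hyperedges are those of $\mathcal{S}$ together with all sets $A \cup \{u\}$ with $A \subseteq V(\mathcal{S})$, $|A| = r-1$. A friendship $r$-hypergraph $\mathcal{H}$ on $n$ vertices is called universal if $\mathcal{H} \cong U_r(\mathcal{S})$ for some $S(r-1,r,n-1)$ Steiner system $\mathcal{S}$. *)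

theory Defs
  imports Complex_Main "HOL-Library.Ramsey"
begin

record 'a hypergraph =
  verts :: "'a set"
  edges :: "'a set set"

definition uniform_hypergraph :: "nat \<Rightarrow> 'a hypergraph \<Rightarrow> bool" where
  "uniform_hypergraph r H \<longleftrightarrow> edges H \<subseteq> nsets (verts H) r"

definition on_vertices :: "'a hypergraph \<Rightarrow> nat \<Rightarrow> bool" where
  "on_vertices H n \<longleftrightarrow> finite (verts H) \<and> card (verts H) = n"

definition is_friend :: "nat \<Rightarrow> 'a hypergraph \<Rightarrow> 'a set \<Rightarrow> 'a \<Rightarrow> bool" where
  "is_friend r H A u \<longleftrightarrow>
     u \<in> verts H \<and> u \<notin> A \<and> (\<forall>B \<in> nsets A (r - 1). B \<union> {u} \<in> edges H)"

definition friendship_hypergraph :: "nat \<Rightarrow> 'a hypergraph \<Rightarrow> bool" where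
  "friendship_hypergraph r H \<longleftrightarrow>
     uniform_hypergraph r H \<and> (\<forall>A \<in> nsets (verts H) r. \<exists>!u. is_friend r H A u)"

text \<open>\<open>steiner_system r m S\<close> says that \<open>S\<close> is an \<open>S(r - 1, r, m)\<close> Steiner system.\<close>

definition steiner_system :: "nat \<Rightarrow> nat \<Rightarrow> 'a hypergraph \<Rightarrow> bool" where
  "steiner_system r m S \<longleftrightarrow>
     uniform_hypergraph r S \<and> on_vertices S m \<and>
     (\<forall>A \<in> nsets (verts S) (r - 1). \<exists>!e. e \<in> edges S \<and> A \<subseteq> e)"

text \<open>The new vertex is an explicit argument; it is meant to lie outside \<open>verts S\<close>.\<close>

definition universal_extension :: "nat \<Rightarrow> 'a hypergraph \<Rightarrow> 'a \<Rightarrow> 'a hypergraph" where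
  "universal_extension r S u =
     \<lparr>verts = verts S \<union> {u},
      edges = edges S \<union> {A \<union> {u} |A. A \<in> nsets (verts S) (r - 1)}\<rparr>"

definition hypergraph_iso :: "'a hypergraph \<Rightarrow> 'b hypergraph \<Rightarrow> bool" where
  "hypergraph_iso G H \<longleftrightarrow>
     (\<exists>f. bij_betw f (verts G) (verts H) \<and> (\<lambda>e. f ` e) ` edges G = edges H)"

text \<open>
  The Steiner system is taken over the vertex type of \<open>H\<close>. This loses nothing: by
  \<open>universal_if_iso\<close> below, a Steiner system over any other type does as well.
\<close>

definition universal_hypergraph :: "nat \<Rightarrow> nat \<Rightarrow> 'a hypergraph \<Rightarrow> bool" where
  "universal_hypergraph r n H \<longleftrightarrow>
     friendship_hypergraph r H \<and> on_vertices H n \<and>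
     (\<exists>(S :: 'a hypergraph) u. steiner_system r (n - 1) S \<and> u \<notin> verts S \<and>
        hypergraph_iso H (universal_extension r S u))"

lemma nsets_image:
  assumes "inj_on g V" shows "nsets (g ` V) k = (`) g ` nsets V k"
proof (intro equalityI subsetI)
  fix B assume "B \<in> nsets (g ` V) k"
  then have B: "B \<subseteq> g ` V" "finite B" "card B = k" by (auto simp: nsets_def)
  obtain A where A: "A \<subseteq> V" "B = g ` A" using B(1) by (auto simp: subset_image_iff)
  have i: "inj_on g A" using A(1) assms inj_on_subset by blast
  have "A \<in> nsets V k" using A B i by (auto simp: nsets_def card_image finite_image_iff)
  then show "B \<in> (`) g ` nsets V k" using A by blast
next
  fix B assume "B \<in> (`) g ` nsets V k"
  then obtain A where A: "B = g ` A" "A \<subseteq> V" "finite A" "card A = k" by (auto simp: nsets_def)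
  moreover have "inj_on g A" using A(2) assms inj_on_subset by blast
  ultimately show "B \<in> nsets (g ` V) k" by (auto simp: nsets_def card_image)
qed

lemma universal_if_iso:
  fixes H :: "'a hypergraph" and S :: "'b hypergraph"
  assumes H: "friendship_hypergraph r H" "on_vertices H n"
    and S: "steiner_system r (n - 1) S" and u: "u \<notin> verts S"
    and iso: "hypergraph_iso H (universal_extension r S u)"
  shows "universal_hypergraph r n H"
proof -
  let ?U = "universal_extension r S u"
  obtain f where f: "bij_betw f (verts H) (verts ?U)" "(`) f ` edges H = edges ?U"
    using iso by (auto simp: hypergraph_iso_def)
  define g where "g = inv_into (verts H) f"
  have g: "bij_betw g (verts ?U) (verts H)"
    unfolding g_def by (rule bij_betw_inv_into[OF f(1)])
  have vU: "verts ?U = insert u (verts S)" by (simp add: universal_extension_def)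
  have injU: "inj_on g (insert u (verts S))" using g vU by (simp add: bij_betw_def)
  then have inj: "inj_on g (verts S)" by (rule inj_on_subset) auto
  have imgH: "insert (g u) (g ` verts S) = verts H" using g vU by (auto simp: bij_betw_def)
  have HV: "e \<subseteq> verts H" if "e \<in> edges H" for e
    using H that unfolding friendship_hypergraph_def uniform_hypergraph_def nsets_def by blast
  have gf: "g ` f ` e = e" if "e \<in> edges H" for e
    using HV[OF that] f(1) unfolding g_def by (simp add: bij_betw_def inv_into_image_cancel)
  have "(`) g ` edges ?U = (\<lambda>e. g ` f ` e) ` edges H" by (simp add: f(2)[symmetric] image_image)
  also have "\<dots> = edges H" using gf by simp
  finally have eH: "(`) g ` edges ?U = edges H" .
  define T where "T = \<lparr>verts = g ` verts S, edges = (`) g ` edges S\<rparr>"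
  have uS: "uniform_hypergraph r S" and oS: "on_vertices S (n - 1)"
    and xS: "\<And>A. A \<in> nsets (verts S) (r - 1) \<Longrightarrow> \<exists>!e. e \<in> edges S \<and> A \<subseteq> e"
    using S by (simp_all only: steiner_system_def)
  have eS: "e \<subseteq> verts S" if "e \<in> edges S" for e
    using uS that by (auto simp: uniform_hypergraph_def nsets_def)
  have ns: "nsets (g ` verts S) k = (`) g ` nsets (verts S) k" for k
    by (rule nsets_image[OF inj])
  have "steiner_system r (n - 1) T"
    unfolding steiner_system_def
  proof (intro conjI ballI)
    show "uniform_hypergraph r T"
      using uS by (simp add: T_def uniform_hypergraph_def ns image_mono)
    show "on_vertices T (n - 1)"
      using oS inj by (simp add: T_def on_vertices_def card_image)
  next
    fix A assume "A \<in> nsets (verts T) (r - 1)"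
    then obtain B where B: "A = g ` B" "B \<in> nsets (verts S) (r - 1)"
      by (auto simp: T_def ns)
    then have BV: "B \<subseteq> verts S" by (auto simp: nsets_def)
    obtain e where e: "e \<in> edges S" "B \<subseteq> e" "\<And>e'. e' \<in> edges S \<Longrightarrow> B \<subseteq> e' \<Longrightarrow> e' = e"
      using xS[OF B(2)] by (elim ex1E) blast
    show "\<exists>!e. e \<in> edges T \<and> A \<subseteq> e"
    proof (rule ex1I[of _ "g ` e"])
      show "g ` e \<in> edges T \<and> A \<subseteq> g ` e"
        using e(1,2) B(1) by (simp add: T_def image_mono)
    next
      fix d assume "d \<in> edges T \<and> A \<subseteq> d"
      then have d: "d \<in> (`) g ` edges S" "g ` B \<subseteq> d" using B(1) by (simp_all add: T_def)
      then obtain e' where e': "e' \<in> edges S" "d = g ` e'" by (elim imageE)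
      have "B \<subseteq> e'"
      proof
        fix x assume "x \<in> B"
        then have "x \<in> verts S" "g x \<in> g ` e'" using BV d(2) e'(2) by blast+
        then show "x \<in> e'" using inj_on_image_mem_iff[OF inj _ eS[OF e'(1)]] by simp
      qed
      from e(3)[OF e'(1) this] show "d = g ` e" using e'(2) by simp
    qed
  qed
  moreover have "g u \<notin> verts T"
    using injU u by (auto simp: T_def)
  moreover have "universal_extension r T (g u) = \<lparr>verts = verts H, edges = edges H\<rparr>"
  proof -
    have "(`) g ` edges ?U = edges T \<union> {A \<union> {g u} |A. A \<in> nsets (verts T) (r - 1)}"
      by (simp add: universal_extension_def T_def ns image_Un setcompr_eq_image image_image)
    then show ?thesis using eH imgH by (simp add: universal_extension_def T_def)
  qed
  then have "hypergraph_iso H (universal_extension r T (g u))"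
    unfolding hypergraph_iso_def by (intro exI[of _ id]) simp
  ultimately show ?thesis using H unfolding universal_hypergraph_def by blast
qed

end

theory Submission imports Defs begin

text \<open>
  Adding its friend to an edge gives a complete \<open>(r + 1)\<close>-set, and this is the only one containing
  the edge, so the edges split into \<open>q\<close> cliques and \<open>|E| = (r + 1) q\<close>. Work with simplicial
  boundaries over the field with two elements. For an \<open>r\<close>-set \<open>A\<close> with friend \<open>u\<close>, the boundary of
  \<open>A\<close> is the sum of those of the other \<open>r\<close>-subsets of \<open>A \<union> {u}\<close>, which are edges. Hence the
  boundaries of the edges span all boundaries, even after one edge of each clique is deleted. As the
  \<open>r\<close>-sets through a fixed vertex have independent boundaries, \<open>binomial (n - 1) (r - 1) \<le> r q\<close>.

  In the case of equality the remaining edges have independent boundaries, so every cycle inside \<open>E\<close>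
  is a union of cliques. Let \<open>X\<close> be an \<open>(r + 1)\<close>-set and replace every non-edge \<open>A\<close> in the boundary
  of \<open>X\<close> by the other facets of \<open>A \<union> {friend A}\<close>. Comparing the resulting cycle with the cliques it
  must consist of shows that all non-edges in \<open>X\<close> have the same friend, and that \<open>X\<close> with two edges
  and a non-edge \<open>A\<close> is \<open>A \<union> {friend A}\<close>. By induction on \<open>|A' - A|\<close>, all non-edges have one common
  friend \<open>u\<close>; every \<open>r\<close>-set containing \<open>u\<close> is then an edge, and \<open>H\<close> is universal.
\<close>

section \<open>Chains and boundaries over the field with two elements\<close>

text \<open>A finite family of sets stands for the chain in which its members have coefficient 1, so
  \<open>sym_diff\<close> is addition; on families of (k + 1)-subsets of \<open>V\<close> this is
  the simplicial boundary.\<close>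

definition boundary :: "'a set \<Rightarrow> nat \<Rightarrow> 'a set set \<Rightarrow> 'a set set" where
  "boundary V k C = {B \<in> nsets V k. odd (card {e \<in> C. B \<subseteq> e})}"

lemma boundary_sym_diff:
  assumes "finite C" "finite D"
  shows "boundary V k (sym_diff C D) = sym_diff (boundary V k C) (boundary V k D)"
proof -
  have "odd (card {e \<in> sym_diff C D. B \<subseteq> e}) \<longleftrightarrow>
      odd (card {e \<in> C. B \<subseteq> e}) \<noteq> odd (card {e \<in> D. B \<subseteq> e})" for B
  proof -
    let ?P = "{e \<in> C - D. B \<subseteq> e}" and ?Q = "{e \<in> D - C. B \<subseteq> e}" and ?I = "{e \<in> C \<inter> D. B \<subseteq> e}"
    have fin: "finite ?P" "finite ?Q" "finite ?I" using assms by auto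
    have "{e \<in> sym_diff C D. B \<subseteq> e} = ?P \<union> ?Q" "{e \<in> C. B \<subseteq> e} = ?P \<union> ?I"
      "{e \<in> D. B \<subseteq> e} = ?Q \<union> ?I" by auto
    moreover have "card (?P \<union> ?Q) = card ?P + card ?Q" "card (?P \<union> ?I) = card ?P + card ?I"
      "card (?Q \<union> ?I) = card ?Q + card ?I"
      using fin by (intro card_Un_disjoint; auto)+
    ultimately show ?thesis by auto
  qed
  then show ?thesis by (auto simp: boundary_def)
qed

lemma boundary_empty [simp]: "boundary V k {} = {}"
  by (simp add: boundary_def)

text \<open>A \<open>k\<close>-set \<open>B\<close> inside \<open>K\<close> lies in exactly two
  facets of \<open>K\<close>, one for each of the two elements of \<open>K - B\<close>.\<close>

lemma boundary_facets:
  assumes "card K = k + 2"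
  shows "boundary V k (nsets K (Suc k)) = {}"
proof -
  have fK: "finite K" using assms card.infinite by fastforce
  have "even (card {e \<in> nsets K (Suc k). B \<subseteq> e})" if B: "B \<in> nsets V k" for B
  proof (cases "B \<subseteq> K")
    case False
    then have "{e \<in> nsets K (Suc k). B \<subseteq> e} = {}" by (auto simp: nsets_def)
    then show ?thesis by (simp only: card.empty) simp
  next
    case True
    have fB: "finite B" and cB: "card B = k" using B by (auto simp: nsets_def)
    have "card (K - B) = 2" using True assms cB fB by (simp add: card_Diff_subset)
    have "{e \<in> nsets K (Suc k). B \<subseteq> e} = (\<lambda>x. insert x B) ` (K - B)"
    proof (intro equalityI subsetI)
      fix e assume "e \<in> {e \<in> nsets K (Suc k). B \<subseteq> e}"
      then have e: "e \<subseteq> K" "finite e" "card e = Suc k" "B \<subseteq> e" by (auto simp: nsets_def)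
      then have "card (e - B) = 1" using fB cB by (simp add: card_Diff_subset)
      then obtain x where "e - B = {x}" by (auto simp: card_1_singleton_iff)
      then show "e \<in> (\<lambda>x. insert x B) ` (K - B)" using e by blast
    next
      fix e assume "e \<in> (\<lambda>x. insert x B) ` (K - B)"
      then show "e \<in> {e \<in> nsets K (Suc k). B \<subseteq> e}"
        using True fB cB by (auto simp: nsets_def)
    qed
    moreover have "inj_on (\<lambda>x. insert x B) (K - B)" by (auto simp: inj_on_def)
    ultimately show ?thesis using \<open>card (K - B) = 2\<close> by (simp only: card_image) simp
  qed
  then show ?thesis by (auto simp: boundary_def)
qed

lemma boundary_singleton:
  assumes "K \<subseteq> V"
  shows "boundary V k {K} = nsets K k"
proof -
  have "{e \<in> {K}. B \<subseteq> e} = (if B \<subseteq> K then {K} else {})" for B by auto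
  then show ?thesis using assms by (auto simp: boundary_def nsets_def)
qed

lemma finite_boundary: "finite V \<Longrightarrow> finite (boundary V k C)"
  using finite_imp_finite_nsets[of V k] by (simp add: boundary_def)

lemma boundary_boundary:
  assumes "finite V" "finite F" "F \<subseteq> nsets V (k + 2)"
  shows "boundary V k (boundary V (Suc k) F) = {}"
  using assms(2,3)
proof (induction F rule: finite_induct)
  case (insert K F)
  have K: "K \<subseteq> V" "card K = k + 2" and F: "F \<subseteq> nsets V (k + 2)"
    using insert by (auto simp: nsets_def)
  have "finite (nsets K (Suc k))"
    by (metis K(1) assms(1) finite_subset finite_imp_finite_nsets)
  moreover have "insert K F = sym_diff {K} F" using insert.hyps by auto
  then have "boundary V (Suc k) (insert K F) = sym_diff (nsets K (Suc k)) (boundary V (Suc k) F)"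
    using boundary_sym_diff[of "{K}" F V "Suc k"] insert.hyps boundary_singleton[OF K(1)] by simp
  ultimately show ?case
    using insert.IH[OF F] boundary_facets[OF K(2), of V] finite_boundary[OF assms(1)]
    by (simp only: boundary_sym_diff) simp
qed simp

text \<open>The facet of \<open>e\<close> avoiding \<open>v\<close> lies in no other member of the
  star of \<open>v\<close>, so it cannot cancel. Hence the chain is recovered by coning with
  \<open>v\<close> the part of its boundary that avoids \<open>v\<close>.\<close>

lemma inj_on_boundary_star:
  assumes "finite V"
  shows "inj_on (boundary V k) (Pow {e \<in> nsets V (Suc k). v \<in> e})"
proof (rule inj_on_inverseI[where g = "\<lambda>\<B>. insert v ` {B \<in> \<B>. v \<notin> B}"])
  fix Q assume "Q \<in> Pow {e \<in> nsets V (Suc k). v \<in> e}"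
  then have Q: "e \<subseteq> V" "card e = Suc k" "v \<in> e" "finite e" if "e \<in> Q" for e
    using that by (auto simp: nsets_def)
  have eq: "e = insert v B" if "e \<in> Q" "B \<subseteq> e" "v \<notin> B" "card B = k" "finite B" for e B
    by (rule card_subset_eq[symmetric]) (use that Q in auto)
  have star: "{e \<in> Q. B \<subseteq> e} = {insert v B} \<inter> Q" if "B \<in> nsets V k" "v \<notin> B" for B
    using eq that by (auto simp: nsets_def)
  have odd_iff: "odd (card ({x} \<inter> Q)) \<longleftrightarrow> x \<in> Q" for x
    by (cases "x \<in> Q") auto
  have "{B \<in> boundary V k Q. v \<notin> B} = {B \<in> nsets V k. v \<notin> B \<and> insert v B \<in> Q}"
    using star odd_iff by (auto simp: boundary_def)
  also have "insert v ` \<dots> = Q"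
  proof (intro equalityI subsetI)
    fix e assume e: "e \<in> Q"
    have "e - {v} \<in> nsets V k" using Q[OF e] by (auto simp: nsets_def)
    moreover have "insert v (e - {v}) = e" using Q[OF e] by auto
    ultimately show "e \<in> insert v ` {B \<in> nsets V k. v \<notin> B \<and> insert v B \<in> Q}"
      using e by (intro image_eqI[of _ _ "e - {v}"]) auto
  qed auto
  finally show "insert v ` {B \<in> boundary V k Q. v \<notin> B} = Q" .
qed

lemma card_star:
  assumes "finite V" "v \<in> V"
  shows "card {e \<in> nsets V (Suc k). v \<in> e} = (card V - 1) choose k"
proof -
  have "{e \<in> nsets V (Suc k). v \<in> e} = insert v ` nsets (V - {v}) k"
  proof (intro equalityI subsetI)
    fix e assume "e \<in> {e \<in> nsets V (Suc k). v \<in> e}"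
    then have "e - {v} \<in> nsets (V - {v}) k" "e = insert v (e - {v})" by (auto simp: nsets_def)
    then show "e \<in> insert v ` nsets (V - {v}) k" by blast
  qed (use assms in \<open>auto simp: nsets_def card_insert_if\<close>)
  moreover have "inj_on (insert v) (nsets (V - {v}) k)"
    by (auto simp: inj_on_def nsets_def)
  ultimately show ?thesis using assms by (simp add: card_image)
qed

lemma boundary_insert:
  assumes "finite Q" "D \<notin> Q"
  shows "boundary V k (insert D Q) = sym_diff (boundary V k Q) (boundary V k {D})"
proof -
  have "insert D Q = sym_diff Q {D}" using assms by auto
  then show ?thesis using boundary_sym_diff[OF assms(1), of "{D}"] by simp
qed

lemma boundary_span:
  assumes "finite W" and single: "\<And>D. D \<in> \<A> \<Longrightarrow> \<exists>X\<subseteq>W. boundary V k X = boundary V k {D}"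
    and "finite Q" "Q \<subseteq> \<A>"
  shows "\<exists>X\<subseteq>W. boundary V k X = boundary V k Q"
  using assms(3,4)
proof (induction Q rule: finite_induct)
  case (insert D Q)
  obtain X where X: "X \<subseteq> W" "boundary V k X = boundary V k Q" using insert by auto
  obtain Y where Y: "Y \<subseteq> W" "boundary V k Y = boundary V k {D}"
    using single[of D] insert by blast
  have "finite X" "finite Y" using X Y assms(1) finite_subset by blast+
  then have "boundary V k (sym_diff X Y) = boundary V k (insert D Q)"
    by (simp only: boundary_sym_diff boundary_insert[OF insert.hyps] X Y)
  moreover have "sym_diff X Y \<subseteq> W" using X Y by auto
  ultimately show ?case by blast
qed auto

text \<open>A dimension count without vector spaces: subsets of \<open>W\<close> realize at least
  the boundaries of the star, whose number is 2 to the power \<open>card ?R\<close>, and at most 2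
  to the power \<open>card W\<close>. If the exponents agree, no two subsets of \<open>W\<close>
  share a boundary, which is linear independence.\<close>

lemma boundary_spanning:
  assumes "finite V" "v \<in> V" "W \<subseteq> nsets V (Suc k)"
    and span: "\<And>D. D \<in> nsets V (Suc k) \<Longrightarrow> \<exists>X\<subseteq>W. boundary V k X = boundary V k {D}"
  shows "(card V - 1) choose k \<le> card W"
    and "(card V - 1) choose k = card W \<Longrightarrow> inj_on (boundary V k) (Pow W)"
proof -
  let ?R = "{e \<in> nsets V (Suc k). v \<in> e}"
  have finr: "finite (nsets V (Suc k))" using assms(1) by (simp add: finite_imp_finite_nsets)
  then have fW: "finite W" using assms(3) finite_subset by blast
  have sub: "boundary V k ` Pow ?R \<subseteq> boundary V k ` Pow W"
  proof (rule image_subsetI)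
    fix Q assume "Q \<in> Pow ?R"
    then have Q: "Q \<subseteq> nsets V (Suc k)" by auto
    then have "finite Q" using finr by (rule finite_subset)
    have "\<exists>X\<subseteq>W. boundary V k X = boundary V k Q"
      by (rule boundary_span[OF fW _ \<open>finite Q\<close> Q]) (rule span)
    then obtain X where "X \<subseteq> W" "boundary V k X = boundary V k Q" by blast
    then show "boundary V k Q \<in> boundary V k ` Pow W" by (intro image_eqI[of _ _ X]) simp_all
  qed
  have "2 ^ card ?R = card (boundary V k ` Pow ?R)"
    using inj_on_boundary_star[OF assms(1), of k v] finr by (simp add: card_image card_Pow)
  also have "\<dots> \<le> card (boundary V k ` Pow W)"
    using fW by (intro card_mono[OF _ sub]) simp
  finally have le: "2 ^ card ?R \<le> card (boundary V k ` Pow W)" .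
  have le': "card (boundary V k ` Pow W) \<le> 2 ^ card W"
    using card_image_le[of "Pow W"] fW by (simp add: card_Pow)
  show "(card V - 1) choose k \<le> card W"
    using power_le_imp_le_exp[OF _ order.trans[OF le le']] card_star[OF assms(1,2), of k] by simp
  show "inj_on (boundary V k) (Pow W)" if "(card V - 1) choose k = card W"
  proof (rule eq_card_imp_inj_on)
    show "card (boundary V k ` Pow W) = card (Pow W)"
      using le le' that card_star[OF assms(1,2), of k] fW by (simp add: card_Pow)
  qed (use fW in simp)
qed

section \<open>Friends and the clique decomposition of the edges\<close>

locale friendship =
  fixes H :: "'a hypergraph" and r :: nat
  assumes r: "r \<ge> 3"
    and friendship: "friendship_hypergraph r H"
    and finite_V: "finite (verts H)"
begin

abbreviation "V \<equiv> verts H"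
abbreviation "E \<equiv> edges H"

definition friend :: "'a set \<Rightarrow> 'a" where
  "friend A = (THE u. is_friend r H A u)"

abbreviation closure :: "'a set \<Rightarrow> 'a set" where
  "closure A \<equiv> insert (friend A) A"

lemma E_nsets: "E \<subseteq> nsets V r"
  using friendship by (simp add: friendship_hypergraph_def uniform_hypergraph_def)

lemma finite_nsets_V: "finite (nsets V k)"
  using finite_V by (simp add: finite_imp_finite_nsets)

lemma finite_E: "finite E"
  using E_nsets finite_nsets_V finite_subset by blast

text \<open>The sets \<open>B \<union> {u}\<close> in the definition of a friend are exactly the
  facets of \<open>insert u A\<close> other than \<open>A\<close>.\<close>

lemma is_friend_iff:
  assumes "A \<in> nsets V r"
  shows "is_friend r H A u \<longleftrightarrow> u \<in> V \<and> u \<notin> A \<and> nsets (insert u A) r - {A} \<subseteq> E"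
proof -
  have A: "finite A" "card A = r" "A \<subseteq> V" using assms by (auto simp: nsets_def)
  have "(\<forall>B \<in> nsets A (r - 1). B \<union> {u} \<in> E) \<longleftrightarrow> nsets (insert u A) r - {A} \<subseteq> E" if u: "u \<notin> A"
  proof -
    have "nsets (insert u A) r - {A} = insert u ` nsets A (r - 1)"
    proof (intro equalityI subsetI)
      fix e assume "e \<in> nsets (insert u A) r - {A}"
      then have e: "e \<subseteq> insert u A" "finite e" "card e = r" "e \<noteq> A" by (auto simp: nsets_def)
      then have "u \<in> e" using card_subset_eq[of A e] A by auto
      then have "e - {u} \<in> nsets A (r - 1)" "e = insert u (e - {u})" using e by (auto simp: nsets_def)
      then show "e \<in> insert u ` nsets A (r - 1)" by blast
    next
      fix e assume "e \<in> insert u ` nsets A (r - 1)"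
      then show "e \<in> nsets (insert u A) r - {A}"
        using u r finite_subset[OF _ A(1)] by (auto simp: nsets_def card_insert_if subset_iff)
    qed
    then show ?thesis by auto
  qed
  then show ?thesis by (auto simp: is_friend_def)
qed

lemma friend:
  assumes "A \<in> nsets V r"
  shows "friend A \<in> V" "friend A \<notin> A" "nsets (closure A) r - {A} \<subseteq> E"
proof -
  have ex: "\<exists>!u. is_friend r H A u" using friendship assms by (simp add: friendship_hypergraph_def)
  then have f: "is_friend r H A (friend A)" unfolding friend_def by (rule theI')
  then show "friend A \<in> V" "friend A \<notin> A" "nsets (closure A) r - {A} \<subseteq> E"
    by (simp_all add: is_friend_iff[OF assms])
qed

lemma friend_unique:
  assumes "A \<in> nsets V r" "u \<in> V" "u \<notin> A" "nsets (insert u A) r - {A} \<subseteq> E"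
  shows "u = friend A"
proof -
  have "\<exists>!u. is_friend r H A u" using friendship assms(1) by (simp add: friendship_hypergraph_def)
  moreover have "is_friend r H A u" using assms by (simp add: is_friend_iff)
  ultimately show ?thesis unfolding friend_def by (rule the1_equality[symmetric])
qed

lemma closure_nsets:
  assumes "A \<in> nsets V r"
  shows "closure A \<in> nsets V (Suc r)"
  using assms friend[OF assms] by (auto simp: nsets_def)

definition cliques :: "'a set set" where
  "cliques = {K \<in> nsets V (Suc r). nsets K r \<subseteq> E}"

lemma closure_clique:
  assumes "A \<in> E"
  shows "closure A \<in> cliques"
  using assms friend[of A] closure_nsets[of A] E_nsets by (auto simp: cliques_def)

text \<open>The one vertex of \<open>K\<close> outside \<open>A\<close> is a friend of
  \<open>A\<close>, hence the friend. Consequently two distinct cliques share no edge.\<close>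

lemma clique_eq_closure:
  assumes "K \<in> cliques" "A \<in> nsets K r"
  shows "K = closure A"
proof -
  have K: "K \<subseteq> V" "card K = Suc r" "finite K" "nsets K r \<subseteq> E" and A: "A \<subseteq> K" "finite A" "card A = r"
    using assms by (auto simp: cliques_def nsets_def)
  then have "card (K - A) = 1" by (simp add: card_Diff_subset)
  then obtain u where "K - A = {u}" by (auto simp: card_1_singleton_iff)
  then have u: "K = insert u A" "u \<notin> A" using A by auto
  moreover have "u = friend A" using u K A assms E_nsets by (intro friend_unique) auto
  ultimately show ?thesis by simp
qed

lemma card_E: "card E = Suc r * card cliques"
proof -
  have fin: "finite cliques" using finite_nsets_V by (simp add: cliques_def)
  have "E = (\<Union>K\<in>cliques. nsets K r)"
  proof (intro equalityI subsetI)
    fix e assume e: "e \<in> E"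
    then have "e \<in> nsets (closure e) r" using E_nsets by (auto simp: nsets_def)
    then show "e \<in> (\<Union>K\<in>cliques. nsets K r)" using closure_clique[OF e] by blast
  qed (auto simp: cliques_def)
  moreover have "card (\<Union>K\<in>cliques. nsets K r) = (\<Sum>K\<in>cliques. card (nsets K r))"
  proof (rule card_UN_disjoint[OF fin])
    show "\<forall>K\<in>cliques. finite (nsets K r)"
      unfolding cliques_def using finite_subset[OF _ finite_E] by blast
    show "\<forall>K\<in>cliques. \<forall>L\<in>cliques. K \<noteq> L \<longrightarrow> nsets K r \<inter> nsets L r = {}"
    proof (intro ballI impI, rule ccontr)
      fix K L assume "K \<in> cliques" "L \<in> cliques" "K \<noteq> L" "nsets K r \<inter> nsets L r \<noteq> {}"
      then show False using clique_eq_closure[of K] clique_eq_closure[of L] by fast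
    qed
  qed
  moreover have "card (nsets K r) = Suc r" if "K \<in> cliques" for K
  proof -
    have "card K = Suc r" using that by (simp add: cliques_def nsets_def)
    then show ?thesis by simp
  qed
  ultimately show ?thesis by simp
qed

section \<open>Deleting one edge from each clique: the lower bound\<close>

text \<open>\<open>c\<close> selects the edge deleted from each clique. It stays arbitrary because
  the extremal case needs a selection adapted to a given cycle.\<close>

context
  fixes c :: "'a set \<Rightarrow> 'a set"
  assumes c: "\<And>K. K \<in> cliques \<Longrightarrow> c K \<in> nsets K r"
begin

lemma card_remaining: "card (E - c ` cliques) = r * card cliques"
proof -
  have "inj_on c cliques"
  proof (rule inj_onI)
    fix K L assume "K \<in> cliques" "L \<in> cliques" "c K = c L"
    then show "K = L"
      using clique_eq_closure[of K "c K"] clique_eq_closure[of L "c L"] c[of K] c[of L] by metis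
  qed
  moreover have "c ` cliques \<subseteq> E" using c by (auto simp: cliques_def)
  moreover have "finite (c ` cliques)" by (rule finite_subset[OF _ finite_E]) fact
  ultimately show ?thesis using card_E by (simp add: card_Diff_subset card_image)
qed

text \<open>\<open>D\<close> and the set \<open>N D\<close> of the other facets of its closure have
  equal boundaries, as their sum is the boundary of a simplex. A non-edge is thereby expressed
  through edges, and a deleted edge through edges that remain.\<close>

lemma remaining_spanning:
  assumes "D \<in> nsets V r"
  shows "\<exists>X\<subseteq>E - c ` cliques. boundary V (r - 1) X = boundary V (r - 1) {D}"
proof -
  let ?W = "E - c ` cliques" and ?b = "boundary V (r - 1)"
  define N where "N D = nsets (closure D) r - {D}" for D
  have finN: "finite (N D)" if "D \<in> nsets V r" for D
    unfolding N_def by (rule finite_subset[OF friend(3)[OF that] finite_E])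
  have bN: "?b (N D) = ?b {D}" if D: "D \<in> nsets V r" for D
  proof -
    have "card (closure D) = r - 1 + 2" using closure_nsets[OF D] r by (simp add: nsets_def)
    then have "?b (nsets (closure D) r) = {}" using boundary_facets[of "closure D" "r - 1" V] r by simp
    moreover have "nsets (closure D) r = sym_diff (N D) {D}"
      using D by (auto simp: N_def nsets_def)
    ultimately have "sym_diff (?b (N D)) (?b {D}) = {}"
      using boundary_sym_diff[of "N D" "{D}"] finN[OF D] by simp
    then show ?thesis by blast
  qed
  have edge: "\<exists>X\<subseteq>?W. ?b X = ?b {D}" if D: "D \<in> E" for D
  proof (cases "D \<in> ?W")
    case True then show ?thesis by blast
  next
    case False
    then obtain K where K: "K \<in> cliques" "D = c K" using D by auto
    then have KD: "K = closure D" using clique_eq_closure c by blast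
    \<comment> \<open>An edge lies in only one clique, and the one edge deleted from
      \<open>K\<close> is \<open>D\<close>, so no other facet of \<open>K\<close> is
      deleted.\<close>
    have "N D \<subseteq> ?W"
    proof
      fix e assume "e \<in> N D"
      then have e: "e \<in> nsets K r" "e \<noteq> D" using KD by (auto simp: N_def)
      have "e \<in> E" using e K by (auto simp: cliques_def)
      moreover have "e \<noteq> c L" if "L \<in> cliques" for L
        using clique_eq_closure[OF that c[OF that]] clique_eq_closure[OF K(1) e(1)] e K by auto
      ultimately show "e \<in> ?W" by auto
    qed
    then show ?thesis using bN D E_nsets by blast
  qed
  have "N D \<subseteq> E" using friend[OF assms] by (simp add: N_def)
  then show ?thesis
    using boundary_span[OF _ edge finN[OF assms]] finite_E bN[OF assms] by auto
qed

lemma choose_le_cliques: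
  assumes "V \<noteq> {}"
  shows "(card V - 1) choose (r - 1) \<le> r * card cliques"
    and "(card V - 1) choose (r - 1) = r * card cliques \<Longrightarrow>
      inj_on (boundary V (r - 1)) (Pow (E - c ` cliques))"
proof -
  obtain v where v: "v \<in> V" using assms by auto
  have r': "Suc (r - 1) = r" using r by simp
  have W: "E - c ` cliques \<subseteq> nsets V (Suc (r - 1))" using E_nsets r' by auto
  show "(card V - 1) choose (r - 1) \<le> r * card cliques"
    using boundary_spanning(1)[OF finite_V v W] remaining_spanning r' card_remaining by simp
  show "inj_on (boundary V (r - 1)) (Pow (E - c ` cliques))"
    if "(card V - 1) choose (r - 1) = r * card cliques"
    using boundary_spanning(2)[OF finite_V v W] remaining_spanning r' card_remaining that by simp
qed

end

lemma choose_le: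
  assumes "V \<noteq> {}"
  shows "(card V - 1) choose (r - 1) \<le> r * card cliques"
proof -
  have "\<exists>e. e \<in> nsets K r" if "K \<in> cliques" for K
  proof -
    have "card K = Suc r" using that by (simp add: cliques_def nsets_def)
    then have "card (nsets K r) \<noteq> 0" by simp
    then show ?thesis by (metis card.empty equals0I)
  qed
  then obtain c where "\<And>K. K \<in> cliques \<Longrightarrow> c K \<in> nsets K r" by metis
  then show ?thesis by (rule choose_le_cliques(1)[OF _ assms])
qed

end

section \<open>The extremal case: cycles of edges\<close>

locale extremal_friendship = friendship +
  assumes V_nonempty: "V \<noteq> {}"
    and extremal: "(card V - 1) choose (r - 1) = r * card cliques"
begin

text \<open>Otherwise each clique has an edge outside \<open>C\<close>. After deleting these, both
  \<open>C\<close> and the empty set consist of remaining edges and have empty boundary, against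
  independence.\<close>

lemma nonempty_cycle_contains_clique:
  assumes C: "C \<subseteq> E" "boundary V (r - 1) C = {}" "C \<noteq> {}"
  shows "\<exists>K\<in>cliques. nsets K r \<subseteq> C"
proof (rule ccontr)
  assume "\<not> ?thesis"
  then have "\<exists>e. e \<in> nsets K r \<and> e \<notin> C" if "K \<in> cliques" for K using that by blast
  then obtain c where c: "\<And>K. K \<in> cliques \<Longrightarrow> c K \<in> nsets K r" "\<And>K. K \<in> cliques \<Longrightarrow> c K \<notin> C"
    by metis
  have "inj_on (boundary V (r - 1)) (Pow (E - c ` cliques))"
    by (rule choose_le_cliques(2)[OF c(1) V_nonempty extremal])
  moreover have "C \<in> Pow (E - c ` cliques)" "{} \<in> Pow (E - c ` cliques)" using C c by auto
  ultimately show False using C by (metis boundary_empty inj_onD)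
qed

text \<open>Removing a whole clique from a cycle leaves a smaller cycle. This is repeated until the
  removed clique contains \<open>D\<close>; that clique is then the closure of
  \<open>D\<close>.\<close>

lemma cycle_union_of_cliques:
  assumes "C \<subseteq> E" "boundary V (r - 1) C = {}" "D \<in> C"
  shows "nsets (closure D) r \<subseteq> C"
  using assms
proof (induction "card C" arbitrary: C rule: less_induct)
  case less
  have "finite C" by (rule finite_subset[OF less.prems(1) finite_E])
  obtain K where K: "K \<in> cliques" "nsets K r \<subseteq> C"
    using nonempty_cycle_contains_clique[of C] less.prems by blast
  show ?case
  proof (cases "D \<in> nsets K r")
    case True
    then show ?thesis using clique_eq_closure[OF K(1) True] K by simp
  next
    case False
    have cK: "card K = Suc r" using K by (simp add: cliques_def nsets_def)
    have "finite (nsets K r)" by (rule finite_subset[OF K(2) \<open>finite C\<close>])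
    then have "boundary V (r - 1) (sym_diff C (nsets K r)) =
        sym_diff (boundary V (r - 1) C) (boundary V (r - 1) (nsets K r))"
      by (rule boundary_sym_diff[OF \<open>finite C\<close>])
    moreover have "sym_diff C (nsets K r) = C - nsets K r" using K(2) by blast
    moreover have "boundary V (r - 1) (nsets K r) = {}"
      using boundary_facets[of K "r - 1" V] cK r by simp
    ultimately have "boundary V (r - 1) (C - nsets K r) = {}" using less.prems(2) by simp
    moreover have "card (C - nsets K r) < card C"
    proof -
      have "nsets K r \<noteq> {}" using cK by (auto simp: nsets_eq_empty_iff)
      then have "C - nsets K r \<subset> C" using K(2) by blast
      then show ?thesis by (rule psubset_card_mono[OF \<open>finite C\<close>])
    qed
    ultimately show ?thesis using less.hyps[of "C - nsets K r"] less.prems(1,3) False by blast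
  qed
qed

text \<open>The cycle \<open>C\<close> below lies in \<open>E\<close> and contains \<open>D = X - {i, j} \<union> {u}\<close>; comparing it with the
  clique through \<open>D\<close>, which it must contain, determines that clique.\<close>

lemma facets_of_friend_outside:
  assumes X: "X \<in> nsets V (Suc r)" and ij: "i \<in> X" "j \<in> X" "i \<noteq> j"
    and non: "X - {i} \<notin> E" and outside: "friend (X - {i}) \<notin> X"
    and j: "X - {j} \<in> E \<or> friend (X - {j}) \<noteq> friend (X - {i})"
  shows "X - {j} \<in> E \<and> (\<forall>j'\<in>X - {j}. X - {j'} \<notin> E)"
proof -
  have X': "X \<subseteq> V" "finite X" "card X = Suc r" using X by (auto simp: nsets_def)
  have ns: "A \<in> nsets V r" if "A \<in> nsets X r" for A using that X' by (auto simp: nsets_def)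
  have sub: "X - {l} \<in> nsets X r" if "l \<in> X" for l using that X' by (auto simp: nsets_def)
  have uniq: "D = A" if "A \<in> nsets X r" "D \<in> nsets V r" "D \<notin> E" "D \<subseteq> closure A" for A D
  proof -
    have "D \<in> nsets (closure A) r" using that by (auto simp: nsets_def)
    then show ?thesis using friend(3)[OF ns[OF that(1)]] that by blast
  qed
  \<comment> \<open>If \<open>closure A\<close> were \<open>X\<close>, the non-edge
    \<open>X - {i}\<close> inside it would have to be \<open>A\<close>, and its friend would lie in
    \<open>X\<close>.\<close>
  have clX: "closure A \<noteq> X" if "A \<in> nsets X r" for A
  proof
    assume "closure A = X"
    moreover then have "X - {i} = A"
      using uniq[OF that, of "X - {i}"] sub ns ij non by auto
    ultimately show False using outside by auto
  qed
  define F where "F = insert X (closure ` (nsets X r - E))"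
  define C where "C = boundary V r F"
  have F: "F \<subseteq> nsets V (Suc r)" using X closure_nsets ns by (auto simp: F_def)
  then have "finite F" using finite_nsets_V finite_subset by blast
  then have cyc: "boundary V (r - 1) C = {}"
    unfolding C_def using boundary_boundary[OF finite_V, of F "r - 1"] F r by simp
  \<comment> \<open>A non-edge in \<open>X\<close> lies in exactly two members of \<open>F\<close>,
    namely \<open>X\<close> and its own closure, and a non-edge not inside \<open>X\<close> lies in
    none. So all non-edges cancel.\<close>
  have CE: "C \<subseteq> E"
  proof
    fix D assume "D \<in> C"
    then have D: "D \<in> nsets V r" "odd (card {e \<in> F. D \<subseteq> e})" by (auto simp: C_def boundary_def)
    show "D \<in> E"
    proof (rule ccontr)
      assume "D \<notin> E"
      have "even (card {e \<in> F. D \<subseteq> e})"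
      proof (cases "D \<subseteq> X")
        case True
        then have DX: "D \<in> nsets X r" using D by (auto simp: nsets_def)
        then have "{e \<in> F. D \<subseteq> e} = {X, closure D}"
          using uniq D(1) \<open>D \<notin> E\<close> True by (auto simp: F_def)
        then show ?thesis using clX[OF DX] by auto
      next
        case False
        then have "{e \<in> F. D \<subseteq> e} = {}"
          using uniq D(1) \<open>D \<notin> E\<close> by (auto simp: F_def nsets_def)
        then show ?thesis by (simp only: card.empty) simp
      qed
      then show False using D by simp
    qed
  qed
  have above: "\<exists>e\<in>F. D \<subseteq> e" if "D \<in> C" for D
  proof -
    have "odd (card {e \<in> F. D \<subseteq> e})" using that by (simp add: C_def boundary_def)
    then have "{e \<in> F. D \<subseteq> e} \<noteq> {}" by (metis card.empty even_zero)
    then show ?thesis by auto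
  qed
  \<comment> \<open>Every member of \<open>F\<close> has at most one vertex outside
    \<open>X\<close>.\<close>
  have small: "x = y" if "D \<in> C" "x \<in> D" "y \<in> D" "x \<notin> X" "y \<notin> X" for D x y
    using above[OF that(1)] that by (auto simp: F_def nsets_def)
  define u where "u = friend (X - {i})"
  have u: "u \<in> V" "u \<notin> X" using friend[OF ns[OF sub[OF ij(1)]]] outside by (auto simp: u_def)
  have inF: "\<exists>l\<in>{a, b}. X - {l} \<notin> E \<and> friend (X - {l}) = u \<and> e = closure (X - {l})"
    if e: "e \<in> F" "insert u (X - {a, b}) \<subseteq> e" for e a b
  proof -
    obtain A where A: "A \<in> nsets X r" "A \<notin> E" "e = closure A" using u e by (auto simp: F_def)
    then have "card (X - A) = 1" using X' by (auto simp: nsets_def card_Diff_subset)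
    then obtain l where "X - A = {l}" by (auto simp: card_1_singleton_iff)
    then have l: "A = X - {l}" "l \<in> X" using A by (auto simp: nsets_def)
    have fA: "friend A = u" using e(2) A l u(2) by auto
    then have "X - {a, b} \<subseteq> A" using e(2) A(3) u(2) by auto
    then have "l = a \<or> l = b" using l by auto
    then show ?thesis using A l fA by auto
  qed
  define D where "D = insert u (X - {i, j})"
  have Dns: "D \<in> nsets V r" using u X' ij r by (auto simp: D_def nsets_def)
  \<comment> \<open>The only other candidate would be the closure of \<open>X - {j}\<close>, which
    the assumption on \<open>j\<close> excludes. So \<open>D\<close> does not cancel.\<close>
  have "{e \<in> F. D \<subseteq> e} = {closure (X - {i})}"
  proof (intro equalityI subsetI)
    fix e assume "e \<in> {e \<in> F. D \<subseteq> e}"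
    then show "e \<in> {closure (X - {i})}" using inF[of e i j] j by (auto simp: D_def u_def)
  next
    fix e assume "e \<in> {closure (X - {i})}"
    then show "e \<in> {e \<in> F. D \<subseteq> e}" using sub ij non by (auto simp: F_def D_def u_def)
  qed
  then have "D \<in> C" using Dns by (simp add: C_def boundary_def)
  then have all: "nsets (closure D) r \<subseteq> C" by (rule cycle_union_of_cliques[OF CE cyc])
  define w where "w = friend D"
  have w: "w \<in> V" "w \<notin> D" using friend[OF Dns] by (auto simp: w_def)
  have cD: "card D = r" "finite D" using Dns by (auto simp: nsets_def)
  have "card (closure D) = Suc r" using closure_nsets[OF Dns] by (simp add: nsets_def)
  then have facet: "insert w D - {x} \<in> C" if "x \<in> insert w D" for x
    using that cD by (intro subsetD[OF all]) (auto simp: nsets_def w_def)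
  \<comment> \<open>Otherwise \<open>u\<close> and \<open>w\<close> are two vertices outside
    \<open>X\<close>, and a facet of the clique keeping both would violate \<open>small\<close>. The
    third vertex to drop exists because \<open>r \<ge> 3\<close>.\<close>
  have "w \<in> X"
  proof (rule ccontr)
    assume "w \<notin> X"
    have "u \<in> D" by (simp add: D_def)
    then have "card (D - {u}) > 0" using cD r by simp
    then obtain x where "x \<in> D - {u}" by (metis card.empty equals0I less_irrefl)
    moreover have "w \<noteq> u" using w by (auto simp: D_def)
    ultimately show False
      using small[OF facet[of x], of u w] \<open>w \<notin> X\<close> u w by (auto simp: D_def)
  qed
  then have "w = i \<or> w = j" using w by (auto simp: D_def)
  have "insert w D - {u} = insert w (X - {i, j})" using w u by (auto simp: D_def)
  then have wE: "insert w (X - {i, j}) \<in> E" using facet[of u] CE by (auto simp: D_def)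
  have "insert j (X - {i, j}) = X - {i}" using ij by auto
  then have "w \<noteq> j" using wE non by metis
  then have wi: "w = i" using \<open>w = i \<or> w = j\<close> by simp
  have "insert i (X - {i, j}) = X - {j}" using ij by auto
  then have jE: "X - {j} \<in> E" using wE wi by simp
  \<comment> \<open>The facet of the clique opposite \<open>j'\<close> lies in \<open>C\<close>,
    hence below a member of \<open>F\<close>. By \<open>inF\<close> this is the closure of a
    non-edge \<open>X - {j}\<close> or \<open>X - {j'}\<close>, and the former is an edge.\<close>
  have "X - {j'} \<notin> E" if j': "j' \<in> X - {j}" for j'
  proof -
    have "insert w D - {j'} = insert u (X - {j, j'})" using wi j' u ij by (auto simp: D_def)
    moreover have "j' \<in> insert w D" using wi j' by (auto simp: D_def)
    ultimately have "insert u (X - {j, j'}) \<in> C" using facet by metis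
    then obtain e where "e \<in> F" "insert u (X - {j, j'}) \<subseteq> e" using above by blast
    then show ?thesis using inF jE by blast
  qed
  then show ?thesis using jE by blast
qed

section \<open>The common friend of all non-edges\<close>

text \<open>Here \<open>X\<close> is the closure of \<open>A\<close>, so \<open>A\<close> is the
  only facet of \<open>X\<close> that can be a non-edge.\<close>

lemma friend_inside:
  assumes "X \<in> nsets V (Suc r)" "A \<in> nsets X r" "friend A \<in> X" "B \<in> nsets X r" "B \<noteq> A"
  shows "B \<in> E"
proof -
  have A: "A \<in> nsets V r" using assms by (auto simp: nsets_def)
  have "card (closure A) = Suc r" using closure_nsets[OF A] by (simp add: nsets_def)
  then have "closure A = X" using assms by (intro card_subset_eq) (auto simp: nsets_def)
  then show ?thesis using friend(3)[OF A] assms by auto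
qed

text \<open>Two non-edges in \<open>X\<close> force the friend of each out of \<open>X\<close>. If
  the friends differed, \<open>facets_of_friend_outside\<close> would make \<open>X - {k}\<close> an
  edge.\<close>

lemma adjacent_nonedges_same_friend:
  assumes X: "X \<in> nsets V (Suc r)" and ik: "i \<in> X" "k \<in> X"
    and non: "X - {i} \<notin> E" "X - {k} \<notin> E"
  shows "friend (X - {i}) = friend (X - {k})"
proof (cases "i = k")
  case False
  have "X - {l} \<in> nsets X r" if "l \<in> X" for l using that X by (auto simp: nsets_def)
  then have "friend (X - {i}) \<notin> X" using friend_inside[OF X, of "X - {i}" "X - {k}"] ik non False by auto
  then show ?thesis using facets_of_friend_outside[OF X ik False non(1)] non(2) by metis
qed simp

text \<open>If the friend of \<open>A\<close> were outside \<open>insert b A\<close>, the edge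
  opposite \<open>a\<close> would be the only edge among the facets, but the facet opposite
  \<open>c\<close> is an edge too.\<close>

lemma friend_if_two_edges:
  assumes X: "insert b A \<in> nsets V (Suc r)" "b \<notin> A" "A \<notin> E"
    and ac: "a \<in> A" "c \<in> A" "a \<noteq> c" "insert b A - {a} \<in> E" "insert b A - {c} \<in> E"
  shows "b = friend A"
proof -
  have eq: "insert b A - {b} = A" using X by auto
  have "friend A \<in> insert b A"
    using facets_of_friend_outside[OF X(1), of b a] X ac eq by auto
  moreover have "A \<in> nsets V r" using X by (auto simp: nsets_def)
  ultimately show ?thesis using friend by blast
qed

text \<open>Exchange a vertex of \<open>A - A'\<close> for one of \<open>A' - A\<close>. If some
  exchange gives a non-edge, it has the friend of \<open>A\<close> and is closer to
  \<open>A'\<close>. If all exchanges give edges and \<open>A' - A\<close> has two elements,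
  \<open>friend_if_two_edges\<close> makes both of them the friend of \<open>A\<close>, which is
  absurd; if it has one, the exchange gives \<open>A'\<close> itself, a non-edge.\<close>

lemma nonedges_same_friend:
  assumes "A \<in> nsets V r - E" "A' \<in> nsets V r - E"
  shows "friend A = friend A'"
  using assms
proof (induction "card (A' - A)" arbitrary: A rule: less_induct)
  case less
  then have A: "A \<in> nsets V r" "A \<notin> E" "finite A" "card A = r" "A \<subseteq> V"
    and A': "finite A'" "card A' = r" "A' \<subseteq> V" by (auto simp: nsets_def)
  have diff: "card (A - A') = card (A' - A)"
  proof -
    have "card (A - A') = r - card (A \<inter> A')" "card (A' - A) = r - card (A \<inter> A')"
      using A A' by (simp_all add: card_Diff_subset_Int Int_commute)
    then show ?thesis by simp
  qed
  have X: "insert b A \<in> nsets V (Suc r)" if "b \<in> A' - A" for b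
    using that A A' by (auto simp: nsets_def)
  have near: "friend (insert b A - {a}) = friend A"
    if "a \<in> A" "b \<in> A' - A" "insert b A - {a} \<notin> E" for a b
  proof -
    have "insert b A - {b} = A" using that by auto
    then show ?thesis
      using adjacent_nonedges_same_friend[OF X[OF that(2)], of a b] that A(2) by simp
  qed
  show ?case
  proof (cases "\<exists>a\<in>A - A'. \<exists>b\<in>A' - A. insert b A - {a} \<notin> E")
    case True
    then obtain a b where ab: "a \<in> A - A'" "b \<in> A' - A" "insert b A - {a} \<notin> E" by blast
    then have "insert b A - {a} \<in> nsets V r - E" using X[OF ab(2)] by (auto simp: nsets_def)
    moreover have "A' - (insert b A - {a}) \<subset> A' - A" using ab by auto
    then have "card (A' - (insert b A - {a})) < card (A' - A)" using A' by (intro psubset_card_mono) auto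
    ultimately have "friend (insert b A - {a}) = friend A'"
      using less.hyps less.prems(2) by blast
    moreover have "friend (insert b A - {a}) = friend A" using near[of a b] ab by blast
    ultimately show ?thesis by simp
  next
    case all: False
    show ?thesis
    proof (cases "\<exists>b c. b \<in> A' - A \<and> c \<in> A' - A \<and> b \<noteq> c")
      case True
      then obtain b c where bc: "b \<in> A' - A" "c \<in> A' - A" "b \<noteq> c" by blast
      then have "2 \<le> card (A' - A)" using A' card_mono[of "A' - A" "{b, c}"] by auto
      then obtain x y where xy: "x \<in> A - A'" "y \<in> A - A'" "x \<noteq> y"
        using card_le_Suc0_iff_eq[of "A - A'"] diff A(3) by fastforce
      have "d = friend A" if "d \<in> A' - A" for d
        using all xy that A(2) by (intro friend_if_two_edges[OF X[OF that], of x y]) blast+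
      then show ?thesis using bc by metis
    next
      case False
      then consider "A' - A = {}" | b where "A' - A = {b}" by blast
      then show ?thesis
      proof cases
        case 1
        then have "A' = A" using A A' by (intro card_subset_eq) auto
        then show ?thesis by simp
      next
        case 2
        then obtain a where "A - A' = {a}" using diff by (auto simp: card_1_singleton_iff)
        then have "insert b A - {a} = A'" using 2 by auto
        moreover have "insert b A - {a} \<in> E" using all 2 \<open>A - A' = {a}\<close> by blast
        ultimately show ?thesis using less.prems(2) by simp
      qed
    qed
  qed
qed

text \<open>A non-edge containing the common friend of all non-edges would contain its own
  friend.\<close>

lemma universal_vertex:
  obtains u where "u \<in> V" "{e \<in> nsets V r. u \<in> e} \<subseteq> E"
proof (cases "nsets V r \<subseteq> E")
  case True
  then show ?thesis using that V_nonempty by blast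
next
  case False
  then obtain A where A: "A \<in> nsets V r - E" by blast
  show ?thesis
  proof (rule that[of "friend A"])
    show "friend A \<in> V" using A friend by blast
    show "{e \<in> nsets V r. friend A \<in> e} \<subseteq> E"
      using nonedges_same_friend[OF A] friend by fastforce
  qed
qed

end

section \<open>From a universal vertex to a Steiner system\<close>

context friendship
begin

text \<open>The Steiner system consists of the edges avoiding \<open>u\<close>. For an (r - 1)-set
  \<open>B\<close> avoiding \<open>u\<close>, the vertices completing \<open>B\<close> to such an
  edge are exactly the friends of \<open>insert u B\<close>, so there is one.\<close>

lemma universal_if_universal_vertex:
  assumes u: "u \<in> V" "{e \<in> nsets V r. u \<in> e} \<subseteq> E"
  shows "universal_hypergraph r (card V) H"
proof -
  define S where "S = \<lparr>verts = V - {u}, edges = {e \<in> E. u \<notin> e}\<rparr>"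
  have "steiner_system r (card V - 1) S"
    unfolding steiner_system_def
  proof (intro conjI ballI)
    show "uniform_hypergraph r S" using E_nsets by (auto simp: S_def uniform_hypergraph_def nsets_def)
    show "on_vertices S (card V - 1)" using u finite_V by (simp add: S_def on_vertices_def)
  next
    fix B assume "B \<in> nsets (verts S) (r - 1)"
    then have B: "B \<subseteq> V" "u \<notin> B" "finite B" "card B = r - 1" by (auto simp: S_def nsets_def)
    let ?A = "insert u B"
    have A: "?A \<in> nsets V r" using B u r by (auto simp: nsets_def)
    then have AE: "?A \<in> E" using u by auto
    let ?w = "friend ?A"
    have w: "?w \<in> V" "?w \<noteq> u" "?w \<notin> B" using friend[OF A] by auto
    have wB: "insert ?w B \<in> nsets V r" using w B r by (auto simp: nsets_def)
    show "\<exists>!e. e \<in> edges S \<and> B \<subseteq> e"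
    proof (rule ex1I[of _ "insert ?w B"])
      have "insert ?w B \<in> nsets (closure ?A) r" using wB by (auto simp: nsets_def)
      then have "insert ?w B \<in> E" using friend(3)[OF A] B w by auto
      then show "insert ?w B \<in> edges S \<and> B \<subseteq> insert ?w B" using w B by (auto simp: S_def)
    next
      fix e assume "e \<in> edges S \<and> B \<subseteq> e"
      then have e: "e \<in> E" "u \<notin> e" "B \<subseteq> e" by (auto simp: S_def)
      then have e': "e \<subseteq> V" "finite e" "card e = r" using E_nsets by (auto simp: nsets_def)
      then have "card (e - B) = 1" using B e r by (simp add: card_Diff_subset)
      then obtain x where "e - B = {x}" by (auto simp: card_1_singleton_iff)
      then have x: "e = insert x B" "x \<notin> B" "x \<noteq> u" "x \<in> V" using e e' by auto
      \<comment> \<open>Facets through \<open>u\<close> are edges by assumption, and the only facet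
        avoiding \<open>u\<close> is \<open>e\<close>.\<close>
      have "nsets (insert x ?A) r \<subseteq> E"
      proof
        fix D assume D: "D \<in> nsets (insert x ?A) r"
        then have DV: "D \<in> nsets V r" using A x by (auto simp: nsets_def)
        show "D \<in> E"
        proof (cases "u \<in> D")
          case True then show ?thesis using u DV by auto
        next
          case False
          then have "D = e" using D e' x by (intro card_subset_eq) (auto simp: nsets_def)
          then show ?thesis using e by simp
        qed
      qed
      then have "x = ?w" using x by (intro friend_unique[OF A]) auto
      then show "e = insert ?w B" using x by simp
    qed
  qed
  moreover have "universal_extension r S u = \<lparr>verts = V, edges = E\<rparr>"
  proof -
    have "{A \<union> {u} |A. A \<in> nsets (verts S) (r - 1)} = {e \<in> E. u \<in> e}"
    proof (intro equalityI subsetI)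
      fix e assume "e \<in> {A \<union> {u} |A. A \<in> nsets (verts S) (r - 1)}"
      then obtain A where A: "e = insert u A" "A \<subseteq> V - {u}" "finite A" "card A = r - 1"
        by (auto simp: S_def nsets_def)
      then have "e \<in> nsets V r" using u r by (auto simp: nsets_def card_insert_if)
      then show "e \<in> {e \<in> E. u \<in> e}" using A u by auto
    next
      fix e assume "e \<in> {e \<in> E. u \<in> e}"
      then have "e \<in> nsets V r" "u \<in> e" using E_nsets by auto
      then have "e - {u} \<in> nsets (verts S) (r - 1)" "e = (e - {u}) \<union> {u}"
        by (auto simp: S_def nsets_def)
      then show "e \<in> {A \<union> {u} |A. A \<in> nsets (verts S) (r - 1)}" by blast
    qed
    then show ?thesis using u by (auto simp: universal_extension_def S_def)
  qed
  then have "hypergraph_iso H (universal_extension r S u)"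
    unfolding hypergraph_iso_def by (intro exI[of _ id]) simp
  moreover have "u \<notin> verts S" by (simp add: S_def)
  ultimately show ?thesis
    using friendship finite_V by (auto simp: universal_hypergraph_def on_vertices_def)
qed

end

section \<open>Counting the edges of universal hypergraphs\<close>

text \<open>The edges partition the \<open>k\<close>-sets of vertices, and each edge contains
  \<open>Suc k\<close> of them.\<close>

lemma steiner_system_card_edges:
  assumes "steiner_system (Suc k) m S"
  shows "Suc k * card (edges S) = m choose k"
proof -
  have S: "edges S \<subseteq> nsets (verts S) (Suc k)" "finite (verts S)" "card (verts S) = m"
    and ex1: "\<And>A. A \<in> nsets (verts S) k \<Longrightarrow> \<exists>!e. e \<in> edges S \<and> A \<subseteq> e"
    using assms by (auto simp: steiner_system_def uniform_hypergraph_def on_vertices_def)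
  have fin: "finite (edges S)" using S finite_imp_finite_nsets finite_subset by blast
  have "nsets (verts S) k = (\<Union>e\<in>edges S. nsets e k)"
  proof (intro equalityI subsetI)
    fix A assume "A \<in> nsets (verts S) k"
    with ex1[OF this] show "A \<in> (\<Union>e\<in>edges S. nsets e k)" by (auto simp: nsets_def)
  qed (use S in \<open>auto simp: nsets_def\<close>)
  moreover have "card (\<Union>e\<in>edges S. nsets e k) = (\<Sum>e\<in>edges S. card (nsets e k))"
  proof (rule card_UN_disjoint[OF fin])
    show "\<forall>e\<in>edges S. finite (nsets e k)"
      using S by (auto simp: nsets_def intro!: finite_imp_finite_nsets)
    show "\<forall>e\<in>edges S. \<forall>d\<in>edges S. e \<noteq> d \<longrightarrow> nsets e k \<inter> nsets d k = {}"
    proof (intro ballI impI, rule ccontr)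
      fix e d assume ed: "e \<in> edges S" "d \<in> edges S" "e \<noteq> d" "nsets e k \<inter> nsets d k \<noteq> {}"
      then obtain A where A: "A \<in> nsets e k" "A \<in> nsets d k" by blast
      then have "A \<subseteq> e" "A \<subseteq> d" by (simp_all add: nsets_def)
      moreover have "A \<in> nsets (verts S) k" using S(1) ed(1) A(1) by (auto simp: nsets_def)
      ultimately show False using ex1[of A] ed(1-3) by blast
    qed
  qed
  moreover have "card (nsets e k) = Suc k" if "e \<in> edges S" for e
  proof -
    have "card e = Suc k" using S that by (auto simp: nsets_def)
    then show ?thesis by simp
  qed
  ultimately have "card (nsets (verts S) k) = card (edges S) * Suc k" by simp
  then show ?thesis using S by simp
qed

lemma card_edges_universal_extension:
  assumes "steiner_system (Suc k) m S" "u \<notin> verts S"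
  shows "card (edges (universal_extension (Suc k) S u)) = card (edges S) + (m choose k)"
proof -
  have S: "edges S \<subseteq> nsets (verts S) (Suc k)" "finite (verts S)" "card (verts S) = m"
    using assms by (auto simp: steiner_system_def uniform_hypergraph_def on_vertices_def)
  have fin: "finite (edges S)" using S finite_imp_finite_nsets finite_subset by blast
  have "{A \<union> {u} |A. A \<in> nsets (verts S) k} = insert u ` nsets (verts S) k" by auto
  moreover have "card (insert u ` nsets (verts S) k) = m choose k"
  proof -
    have "inj_on (insert u) (nsets (verts S) k)"
      using assms(2) by (auto simp: inj_on_def nsets_def)
    then show ?thesis using S by (simp add: card_image)
  qed
  moreover have "edges S \<inter> insert u ` nsets (verts S) k = {}"
    using S assms(2) by (auto simp: nsets_def)
  ultimately show ?thesis
    using fin S by (simp add: universal_extension_def card_Un_disjoint finite_imp_finite_nsets)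
qed

lemma card_edges_iso:
  assumes "hypergraph_iso G H" "\<And>e. e \<in> edges G \<Longrightarrow> e \<subseteq> verts G"
  shows "card (edges G) = card (edges H)"
proof -
  obtain f where f: "bij_betw f (verts G) (verts H)" "(`) f ` edges G = edges H"
    using assms(1) by (auto simp: hypergraph_iso_def)
  have "inj_on ((`) f) (edges G)"
    using assms(2) f(1) by (intro inj_on_subset[OF inj_on_image_Pow]) (auto simp: bij_betw_def)
  then show ?thesis using f(2) card_image by fastforce
qed

lemma card_edges_universal:
  assumes "universal_hypergraph (Suc k) n H"
  shows "Suc k * card (edges H) = (k + 2) * ((n - 1) choose k)"
proof -
  obtain S :: "'a hypergraph" and u where S: "steiner_system (Suc k) (n - 1) S" "u \<notin> verts S"
    and iso: "hypergraph_iso H (universal_extension (Suc k) S u)"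
    using assms by (auto simp: universal_hypergraph_def)
  have "e \<subseteq> verts H" if "e \<in> edges H" for e
    using assms that
    by (auto simp: universal_hypergraph_def friendship_hypergraph_def uniform_hypergraph_def nsets_def)
  then have "card (edges H) = card (edges S) + ((n - 1) choose k)"
    using card_edges_iso[OF iso] card_edges_universal_extension[OF S] by simp
  then show ?thesis using steiner_system_card_edges[OF S(1)] by (simp add: algebra_simps)
qed

theorem theorem1:
  fixes H :: "'a hypergraph" and r n :: nat
  assumes "r \<ge> 3"
    and "friendship_hypergraph r H"
    and "on_vertices H n"
    and "n \<ge> r + 1"
  shows "real (card (edges H)) \<ge> (real r + 1) / real r * real ((n - 1) choose (r - 1)) \<and>
    (real (card (edges H)) = (real r + 1) / real r * real ((n - 1) choose (r - 1))
       \<longleftrightarrow> universal_hypergraph r n H)"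
proof -
  have V: "finite (verts H)" "card (verts H) = n" "verts H \<noteq> {}"
    using assms by (auto simp: on_vertices_def)
  interpret friendship H r using assms V by unfold_locales auto
  let ?N = "(n - 1) choose (r - 1)"
  have r0: "real r > 0" using assms by simp
  have "?N \<le> r * card cliques" using choose_le V by simp
  then have le: "real ?N \<le> real r * real (card cliques)" by (metis of_nat_le_iff of_nat_mult)
  \<comment> \<open>In this form the constant cancels, and both claims compare \<open>?N\<close>
    with \<open>r * card cliques\<close>.\<close>
  have cE: "real (card E) = (real r + 1) / real r * (real r * real (card cliques))"
    using r0 by (simp add: card_E field_simps)
  have "universal_hypergraph r n H" if "real (card E) = (real r + 1) / real r * real ?N"
  proof -
    have "(real r + 1) / real r \<noteq> 0" using r0 by simp
    then have "real ?N = real r * real (card cliques)" using that cE by (metis mult_left_cancel)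
    then have "?N = r * card cliques" by (metis of_nat_eq_iff of_nat_mult)
    then interpret extremal_friendship H r using V by unfold_locales auto
    show ?thesis using universal_vertex universal_if_universal_vertex V by metis
  qed
  moreover have "real (card E) = (real r + 1) / real r * real ?N" if "universal_hypergraph r n H"
  proof -
    have "r * card E = (r + 1) * ?N" using card_edges_universal[of "r - 1" n H] that assms by simp
    then have "real r * real (card E) = (real r + 1) * real ?N"
      by (metis of_nat_1 of_nat_add of_nat_mult)
    then show ?thesis using r0 by (simp add: field_simps)
  qed
  moreover have "real (card E) \<ge> (real r + 1) / real r * real ?N"
    unfolding cE using le r0 by (intro mult_left_mono) auto
  ultimately show ?thesis by blast
qed

end
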